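(* Let $X$ be a time-homogeneous Markov chain of order $m\ge1$ on a finite alphabet $A$, with transition kernel $p$, and let $\mathcal{S}$ be its skeleton. Suppose that $\mathcal{S}$ has order $K=m$. If there exists $\mathbf{w}\in\mathcal{S}$ of length $\ell<m$ such that $p(\mathbf{z}\mathbf{w},a)=0$ for some $a\in A$ and some $\mathbf{z}\in A^{m-\ell}$, then $X$ is not irreducible.
   Context: Words: $A$ is a finite set. For $\mathbf{x}\in A^k$, $\mathbf{x}_i^j=(x_i,\dots,x_j)$ for $1\le i\le j\le k$, and $\mathbf{x}_i^j=\mathbf{e}$ (the empty word) if $i>j$; $A^0=\{\mathbf{e}\}$. Juxtaposition denotes concatenation; the length of $\mathbf{x}\in A^k$ is $k$. Kernel: $p:A^m\times A\to[0,1]$, $p(\mathbf{x},a)=P(X_{n+1}=a\mid X_n=x_m,X_{n-1}=x_{m-1},\dots,X_{n-m+1}=x_1)$, so $x_m$ is the most recent symbol, and $\sum_{a\in A}p(\mathbf{x},a)=1$. The stochastic matrix $\mathbb{P}$ on $A^m$ is given by $\mathbb{P}(\mathbf{x},\mathbf{x}_2^m a)=p(\mathbf{x},a)$ for $\mathbf{x}\in A^m$, $a\in A$, all other entries being $0$. $X$ is irreducible if $\mathbb{P}$ is irreducible on $A^m$. Skeleton and its order: for $\mathbf{x}\in A^m$ and $a\in A$, $$\tau(\mathbf{x},a)=\min\{i\ge 0:\ p(\mathbf{y}\mathbf{x}_{m-i}^m,a)=0\ \forall \mathbf{y}\in A^{m-i-1},\ \text{or}\ p(\mathbf{y}\mathbf{x}_{m-i}^m,a)>0\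 \forall \mathbf{y}\in A^{m-i-1}\},$$ $\tau_{\mathbf{x}}=\sup_{a\in A}\tau(\mathbf{x},a)$. The skeleton of $p$ is $\mathcal{S}=\bigcup_{\mathbf{x}\in A^m}\{\mathbf{x}_{m-\tau_{\mathbf{x}}}^m\}$ and its order is $K=1+\sup_{\mathbf{x}\in A^m}\tau_{\mathbf{x}}\in\{1,\dots,m\}$. *)

theory Defs
  imports "HOL-Probability.Probability" "HOL-Library.NList"
begin

text \<open>
  Words over \<open>A\<close> are lists, and \<open>A^k\<close> is \<open>nlists k A\<close>. Words are read in chronological order,
  so the last letter is the most recent symbol.
\<close>

text \<open>
  \<open>subword x i j\<close> is the factor \<open>x_i ... x_j\<close> in 1-based indexing (\<open>1 \<le> i\<close>); it is empty for \<open>i > j\<close>.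
\<close>
definition subword :: "'a list \<Rightarrow> nat \<Rightarrow> nat \<Rightarrow> 'a list" where
  "subword x i j = take (Suc j - i) (drop (i - 1) x)"

definition transition_kernel :: "'a set \<Rightarrow> nat \<Rightarrow> ('a list \<Rightarrow> 'a \<Rightarrow> real) \<Rightarrow> bool" where
  "transition_kernel A m p \<longleftrightarrow>
     (\<forall>x\<in>nlists m A. (\<forall>a\<in>A. 0 \<le> p x a \<and> p x a \<le> 1) \<and> (\<Sum>a\<in>A. p x a) = 1)"

text \<open>
  The first clause on conditional probabilities is the Markov property of order \<open>m\<close>; the second one
  says that \<open>p\<close> gives the transition probabilities at every time. Both are imposed only where the
  conditioning event has positive probability. A process indexed by the integers is covered
  through its restriction to nonnegative times.
\<close>
definition markov_chain_of_order ::
    "'a set \<Rightarrow> nat \<Rightarrow> ('a list \<Rightarrow> 'a \<Rightarrow> real) \<Rightarrow> 'w measure \<Rightarrow> (nat \<Rightarrow> 'w \<Rightarrow> 'a) \<Rightarrow> bool" where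
  "markov_chain_of_order A m p M X \<longleftrightarrow>
     prob_space M \<and>
     (\<forall>n. X n \<in> measurable M (count_space A)) \<and>
     (\<forall>n. \<forall>h\<in>nlists (n + m) A. \<forall>a\<in>A.
        \<P>(\<omega> in M. \<forall>i<n + m. X i \<omega> = h ! i) > 0 \<longrightarrow>
        \<P>(\<omega> in M. X (n + m) \<omega> = a \<bar> \<forall>i<n + m. X i \<omega> = h ! i) =
        \<P>(\<omega> in M. X (n + m) \<omega> = a \<bar> \<forall>i<m. X (n + i) \<omega> = h ! (n + i))) \<and>
     (\<forall>n. \<forall>x\<in>nlists m A. \<forall>a\<in>A.
        \<P>(\<omega> in M. \<forall>i<m. X (n + i) \<omega> = x ! i) > 0 \<longrightarrow>
        \<P>(\<omega> in M. X (n + m) \<omega> = a \<bar> \<forall>i<m. X (n + i) \<omega> = x ! i) = p x a)"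

definition trans_matrix :: "nat \<Rightarrow> ('a list \<Rightarrow> 'a \<Rightarrow> real) \<Rightarrow> 'a list \<Rightarrow> 'a list \<Rightarrow> real" where
  "trans_matrix m p x y = (if y = subword x 2 m @ [last y] then p x (last y) else 0)"

text \<open>Powers of a square matrix whose rows and columns are indexed by the finite set \<open>S\<close>.\<close>
primrec matrix_power :: "'s set \<Rightarrow> ('s \<Rightarrow> 's \<Rightarrow> real) \<Rightarrow> nat \<Rightarrow> 's \<Rightarrow> 's \<Rightarrow> real" where
  "matrix_power S P 0 x y = (if x = y then 1 else 0)"
| "matrix_power S P (Suc n) x y = (\<Sum>z\<in>S. P x z * matrix_power S P n z y)"

text \<open>
  For a stochastic matrix, admitting the exponent \<open>0\<close> makes no difference: if \<open>S\<close> has at least two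
  elements, a positive exponent can always be reached by a detour through another state, and if
  \<open>S\<close> is a singleton, the only entry is 1.
\<close>
definition irreducible_matrix :: "'s set \<Rightarrow> ('s \<Rightarrow> 's \<Rightarrow> real) \<Rightarrow> bool" where
  "irreducible_matrix S P \<longleftrightarrow> (\<forall>x\<in>S. \<forall>y\<in>S. \<exists>n. matrix_power S P n x y > 0)"

definition irreducible_chain :: "'a set \<Rightarrow> nat \<Rightarrow> ('a list \<Rightarrow> 'a \<Rightarrow> real) \<Rightarrow> bool" where
  "irreducible_chain A m p \<longleftrightarrow> irreducible_matrix (nlists m A) (trans_matrix m p)"

text \<open>
  For \<open>x\<close> in \<open>A^m\<close>, \<open>a\<close> in \<open>A\<close> and \<open>m \<ge> 1\<close> the minimum is attained at some \<open>i \<le> m - 1\<close>, since for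
  \<open>i = m - 1\<close> only the empty word \<open>y\<close> is left; so the truncated subtractions are harmless.
\<close>
definition tau :: "'a set \<Rightarrow> nat \<Rightarrow> ('a list \<Rightarrow> 'a \<Rightarrow> real) \<Rightarrow> 'a list \<Rightarrow> 'a \<Rightarrow> nat" where
  "tau A m p x a = (LEAST i.
     (\<forall>y\<in>nlists (m - i - 1) A. p (y @ subword x (m - i) m) a = 0) \<or>
     (\<forall>y\<in>nlists (m - i - 1) A. p (y @ subword x (m - i) m) a > 0))"

definition tau_sup :: "'a set \<Rightarrow> nat \<Rightarrow> ('a list \<Rightarrow> 'a \<Rightarrow> real) \<Rightarrow> 'a list \<Rightarrow> nat" where
  "tau_sup A m p x = (SUP a\<in>A. tau A m p x a)"

definition skeleton :: "'a set \<Rightarrow> nat \<Rightarrow> ('a list \<Rightarrow> 'a \<Rightarrow> real) \<Rightarrow> 'a list set" where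
  "skeleton A m p = (\<Union>x\<in>nlists m A. {subword x (m - tau_sup A m p x) m})"

definition skeleton_order :: "'a set \<Rightarrow> nat \<Rightarrow> ('a list \<Rightarrow> 'a \<Rightarrow> real) \<Rightarrow> nat" where
  "skeleton_order A m p = 1 + (SUP x\<in>nlists m A. tau_sup A m p x)"

end

theory Submission
  imports Defs
begin

text \<open>
  Whether \<open>p(\<cdot>, a)\<close> vanishes at a word ending in an element \<open>w\<close> of the skeleton depends on \<open>w\<close> only.
  So if \<open>p(zw, a) = 0\<close> for one \<open>z\<close>, then the word \<open>wa\<close> can never be produced by a transition. As
  \<open>wa\<close> has length at most \<open>m\<close>, it is a suffix of some state, and the column of that state in the
  transition matrix is zero. There is another state, since \<open>p(zw, \<cdot>)\<close> charges a letter other than \<open>a\<close>.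
\<close>

text \<open>Peel off the first step: if it leads to some \<open>z \<noteq> u\<close>, the remaining
  power vanishes by induction; if it leads to \<open>u\<close>, the step itself has weight 0. The
  condition \<open>x \<noteq> u\<close> settles exponent 0, where the diagonal entry is 1.\<close>

lemma matrix_power_zero_column:
  assumes "\<And>x. x \<in> S \<Longrightarrow> P x u = 0" and "x \<in> S" "x \<noteq> u"
  shows "matrix_power S P n x u = 0"
  using assms(2,3)
proof (induction n arbitrary: x)
  case (Suc n)
  have "P x z * matrix_power S P n z u = 0" if "z \<in> S" for z
    using Suc.IH[OF that] assms(1)[OF Suc.prems(1)] by (cases "z = u") simp_all
  then show ?case unfolding matrix_power.simps by (intro sum.neutral ballI)
qed simp

lemma subword_suffix:
  assumes "length x = m" "i < m"
  shows "subword x (m - i) m = drop (m - i - 1) x"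
  using assms by (simp add: subword_def)

lemma subword_2:
  assumes "length x = m"
  shows "subword x 2 m = tl x"
  using assms by (simp add: subword_def drop_Suc)

text \<open>The index \<open>m - 1\<close> satisfies the defining condition of \<open>tau\<close>:
  only the empty prefix is left, and \<open>p x a\<close> is either zero or positive. So the minimum
  exists and inherits the condition.\<close>

lemma tau_props:
  assumes "transition_kernel A m p" "m \<ge> 1" "x \<in> nlists m A" "a \<in> A"
  shows tau_less: "tau A m p x a < m"
    and tau_dichotomy:
      "(\<forall>y\<in>nlists (m - tau A m p x a - 1) A. p (y @ drop (m - tau A m p x a - 1) x) a = 0) \<or>
       (\<forall>y\<in>nlists (m - tau A m p x a - 1) A. p (y @ drop (m - tau A m p x a - 1) x) a > 0)"
proof -
  let ?Q = "\<lambda>i. (\<forall>y\<in>nlists (m - i - 1) A. p (y @ subword x (m - i) m) a = 0) \<or>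
     (\<forall>y\<in>nlists (m - i - 1) A. p (y @ subword x (m - i) m) a > 0)"
  have len: "length x = m" using assms(3) by simp
  have "0 \<le> p x a" using assms by (auto simp: transition_kernel_def)
  moreover have "subword x (m - (m - 1)) m = x"
    using assms(2) len by (simp add: subword_def)
  ultimately have Q: "?Q (m - 1)" using assms(2) by auto
  then have "tau A m p x a \<le> m - 1" unfolding tau_def by (rule Least_le)
  then show less: "tau A m p x a < m" using assms(2) by simp
  have "?Q (tau A m p x a)" using LeastI[of ?Q, OF Q] unfolding tau_def .
  then show "(\<forall>y\<in>nlists (m - tau A m p x a - 1) A. p (y @ drop (m - tau A m p x a - 1) x) a = 0) \<or>
       (\<forall>y\<in>nlists (m - tau A m p x a - 1) A. p (y @ drop (m - tau A m p x a - 1) x) a > 0)"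
    by (simp only: subword_suffix[OF len less])
qed

text \<open>Since \<open>w\<close> is cut at the supremum over all letters, it contains the shorter
  suffix that decides whether \<open>p\<close> vanishes at the particular letter \<open>a\<close>;
  \<open>z @ w\<close> and \<open>y @ w\<close> share that suffix.\<close>

lemma skeleton_zero_propagates:
  assumes "finite A" "m \<ge> 1" "transition_kernel A m p"
    and w: "w \<in> skeleton A m p" and a: "a \<in> A"
    and z: "z \<in> nlists (m - length w) A" "p (z @ w) a = 0"
    and y: "y \<in> nlists (m - length w) A"
  shows "p (y @ w) a = 0"
proof -
  obtain x where x: "x \<in> nlists m A" and wx: "w = subword x (m - tau_sup A m p x) m"
    using w by (auto simp: skeleton_def)
  define t i where "t = tau_sup A m p x" and "i = tau A m p x a"
  have len: "length x = m" and setx: "set x \<subseteq> A" using x by (simp_all add: nlistsE_set)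
  have bdd: "bdd_above (tau A m p x ` A)" using assms(1) by simp
  have it: "i \<le> t" unfolding i_def t_def tau_sup_def using cSUP_upper[OF a bdd] .
  have "t \<le> m - 1" unfolding t_def tau_sup_def
  proof (rule cSUP_least)
    show "A \<noteq> {}" using a by blast
    show "tau A m p x b \<le> m - 1" if "b \<in> A" for b
      using tau_less[OF assms(3,2) x that] by simp
  qed
  then have tm: "t < m" using assms(2) by simp
  have wd: "w = drop (m - t - 1) x"
    using subword_suffix[OF len tm] wx t_def by simp
  have lw: "m - length w = m - t - 1" using wd len tm by simp
  \<comment> \<open>\<open>w\<close> has \<open>t + 1\<close> letters and the suffix deciding
    \<open>a\<close> has \<open>i + 1\<close>, so \<open>s\<close> collects the \<open>t - i\<close>
    surplus letters; below they are absorbed into the free prefix.\<close>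
  define s where "s = take (t - i) w"
  have "drop (t - i) w = drop (m - i - 1) x" using wd it tm by simp
  then have ws: "w = s @ drop (m - i - 1) x" unfolding s_def by (metis append_take_drop_id)
  have "set s \<subseteq> A"
    using setx wd unfolding s_def by (meson set_drop_subset set_take_subset subset_trans)
  moreover have "length s = t - i" using wd len tm unfolding s_def by simp
  ultimately have ext: "v @ s \<in> nlists (m - i - 1) A" if "v \<in> nlists (m - length w) A" for v
    using that it tm nlistsE_set[OF that] unfolding lw by (intro nlistsI) simp_all
  have "p ((z @ s) @ drop (m - i - 1) x) a = 0" using z(2) ws by simp
  \<comment> \<open>The prefix \<open>z @ s\<close> gives the value 0, which rules out the positive
    alternative.\<close>
  then have "\<forall>v\<in>nlists (m - i - 1) A. p (v @ drop (m - i - 1) x) a = 0"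
    using tau_dichotomy[OF assms(3,2) x a, folded i_def] ext[OF z(1)] by (metis less_irrefl)
  then have "p ((y @ s) @ drop (m - i - 1) x) a = 0" using ext[OF y] by (rule bspec)
  then show ?thesis using ws by simp
qed

lemma skeleton_set:
  assumes "w \<in> skeleton A m p"
  shows "set w \<subseteq> A"
proof -
  obtain x i where "x \<in> nlists m A" "w = subword x i m"
    using assms unfolding skeleton_def by blast
  then show ?thesis
    unfolding subword_def by (metis nlistsE_set set_drop_subset set_take_subset subset_trans)
qed

theorem proposition3:
  fixes A :: "'a set" and m :: nat and p :: "'a list \<Rightarrow> 'a \<Rightarrow> real"
    and M :: "'w measure" and X :: "nat \<Rightarrow> 'w \<Rightarrow> 'a"
  assumes "finite A" and "m \<ge> 1"
    and "transition_kernel A m p"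
    and "markov_chain_of_order A m p M X"
    and "skeleton_order A m p = m"
    and "\<exists>w\<in>skeleton A m p. length w < m \<and>
           (\<exists>a\<in>A. \<exists>z\<in>nlists (m - length w) A. p (z @ w) a = 0)"
  shows "\<not> irreducible_chain A m p"
proof -
  obtain w a z where w: "w \<in> skeleton A m p" "length w < m" and a: "a \<in> A"
    and z: "z \<in> nlists (m - length w) A" "p (z @ w) a = 0"
    using assms(6) by blast
  have setw: "set w \<subseteq> A" using w(1) by (rule skeleton_set)
  \<comment> \<open>\<open>z\<close> is nonempty because \<open>w\<close> is shorter than
    \<open>m\<close>; dropping one letter makes room for \<open>a\<close>, so that \<open>u\<close>
    has length exactly \<open>m\<close>.\<close>
  define v where "v = tl z"
  define u where "u = v @ w @ [a]"
  have "set v \<subseteq> A" using nlistsE_set[OF z(1)] unfolding v_def by (cases z) auto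
  then have u: "u \<in> nlists m A"
    using nlistsE_length[OF z(1)] w(2) a setw by (intro nlistsI) (simp_all add: u_def v_def)
  have column: "trans_matrix m p x u = 0" if x: "x \<in> nlists m A" for x
  \<comment> \<open>A transition shifts out the first letter and appends one, so only states with
    tail \<open>v @ w\<close> can lead to \<open>u\<close>.\<close>
  proof (cases "tl x = v @ w")
    case True
    obtain b where b: "x = b # v @ w" "b \<in> A"
      using nlistsE_length[OF x] nlistsE_set[OF x] True assms(2) by (cases x) auto
    then have "b # v \<in> nlists (m - length w) A" 
      using nlistsE_length[OF x] nlistsE_set[OF x] by (intro nlistsI) auto
    then have "p ((b # v) @ w) a = 0"
      by (rule skeleton_zero_propagates[OF assms(1-3) w(1) a z])
    then show ?thesis using b by (simp add: trans_matrix_def u_def)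
  next
    case False
    then show ?thesis using x by (simp add: trans_matrix_def u_def subword_2)
  qed
  have "z @ w \<in> nlists m A" using nlistsE_length[OF z(1)] nlistsE_set[OF z(1)] w(2) setw
    by (intro nlistsI) auto
  then have "(\<Sum>b\<in>A. p (z @ w) b) = 1" using assms(3) by (simp add: transition_kernel_def)
  then have "(\<Sum>b\<in>A. p (z @ w) b) \<noteq> 0" by simp
  then obtain b where b: "b \<in> A" "p (z @ w) b \<noteq> 0" by (rule sum.not_neutral_contains_not_neutral)
  \<comment> \<open>As \<open>p (z @ w) a = 0\<close>, the letter \<open>b\<close> differs from
    \<open>a\<close>; the constant word in \<open>b\<close> is thus a state with a last letter other
    than that of \<open>u\<close>.\<close>
  define x where "x = replicate m b"
  have x: "x \<in> nlists m A" using b(1) by (simp add: x_def nlists_replicateI)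
  have "last x = b" using assms(2) by (simp add: x_def)
  then have "x \<noteq> u" using b(2) z(2) by (auto simp: u_def)
  then have "matrix_power (nlists m A) (trans_matrix m p) n x u = 0" for n
    by (intro matrix_power_zero_column[where P = "trans_matrix m p"] column x)
  then have "\<not> (\<exists>n. matrix_power (nlists m A) (trans_matrix m p) n x u > 0)" by simp
  then show ?thesis using x u unfolding irreducible_chain_def irreducible_matrix_def by blast
qed

end
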